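(* Let $B\in\mathbb{N}_+$ and let $f:\{0,1\}^B\to\{0,1\}$ be any Boolean function. For every $\delta\in(0,1]$ there exists a Stochastic Boolean Circuit $\mathbf{C}:\Omega\times\{0,1\}^B\to\{0,1\}$ (for some depth, layer widths, temperature and parameters) such that \[ \mathbb{P}\big(\mathbf{C}(x)=f(x)\ \text{for all } x\in\{0,1\}^B\big)\ge 1-\delta. \]
   Context: All random variables live on a probability space $(\Omega,\mathcal{F},\mathbb{P})$. $\operatorname{SM}_N(x)_n=e^{x_n}/\sum_{m=1}^N e^{x_m}$ is the softmax; $e_k$ are standard basis vectors; $\odot$ is entrywise product, $1-v$ is entrywise. Gates: order $\{0,1\}^2$ as $\bar x_1=(0,0),\bar x_2=(0,1),\bar x_3=(1,0),\bar x_4=(1,1)$; enumerate $\{0,1\}^4$ in binary order $Z^{(1)}=(0,0,0,0),\dots,Z^{(16)}=(1,1,1,1)$. Define $\varsigma:\mathbb{R}^2\to\mathbb{R}$ by $\varsigma(x)=e\cdot e^{1/(4\|x\|_2^2-1)}$ if $\|x\|_2<1/2$ and $0$ otherwise, and $\tilde\sigma(x\mid Z)=\sum_{k=1}^4\varsigma(x-\bar x_k)Z_k$. A Stochastic Boolean Circuit (SBC) is specified by a depth $\Delta\in\mathbb{N}_+$, widths $B_0=B,B_1,\dots,B_\Delta=1$, a temperature $\eta>0$, and parameters $W\in\mathbb{R}^{B_1\times 2B_0}$, $W^{(l:\sigma)}\in\mathbb{R}^{B_{l+1}\times16}$, $W^{(l:1)},W^{(l:2)}\in\mathbb{R}^{B_{l+1}\times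 B_l}$ ($l=1,\dots,\Delta-1$). Its random ingredients: (1) for each $i\le B_1$ a random index $q_i\in\{1,\dots,2B_0\}$ with $\mathbb{P}(q_i=k)=\operatorname{SM}_{2B_0}(W_{i:})_k$, and $x^{(1)}_i=x_{q_i}$ if $q_i\le B_0$, $x^{(1)}_i=1-x_{q_i-B_0}$ otherwise; (2) for each $l,j$ random one-hot rows $\mathbf{E}^{(l:1:e)}_{j:},\mathbf{E}^{(l:2:e)}_{j:}\in\{e_1,\dots,e_{B_l}\}$ with $\mathbb{P}(\mathbf{E}^{(l:1:e)}_{j:}=e_k)=\operatorname{SM}(\eta W^{(l:1)}_{j:})_k$ and $\mathbb{P}(\mathbf{E}^{(l:2:e)}_{j:}=e_k)=\operatorname{SM}\big(\eta(1-\operatorname{SM}(\eta W^{(l:1)}_{j:}))\odot\operatorname{SM}(\eta W^{(l:2)}_{j:})\big)_k$; (3) for each $l,j$ a random $K_{l,j}\in\{1,\dots,16\}$ with $\mathbb{P}(K_{l,j}=i)=\operatorname{SM}_{16}(W^{(l:\sigma)}_{j:})_i$ and $\Sigma_{l,j}=\tilde\sigma(\cdot\mid Z^{(K_{l,j})})$. The recursion is $x^{(l+1)}_j=\Sigma_{l,j}\big(\mathbf{E}^{(l:1:e)}_{j:}x^{(l)},\mathbf{E}^{(l:2:e)}_{j:}x^{(l)}\big)$ for $l=1,\dots,\Delta-1$, and $\mathbf{C}(x)=x^{(\Delta)}$. *)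

theory Defs
  imports "HOL-Probability.Probability"
begin

text \<open>
  Vectors of length \<open>N\<close> are functions on \<^typ>\<open>nat\<close> of which only the entries \<open>1, \<dots>, N\<close>
  are used; matrices are curried with the row index first. All indices start at 1.
\<close>

definition softmax :: "nat \<Rightarrow> (nat \<Rightarrow> real) \<Rightarrow> nat \<Rightarrow> real" where
  "softmax N v n = exp (v n) / (\<Sum>m=1..N. exp (v m))"

definition unit_vec :: "nat \<Rightarrow> nat \<Rightarrow> real" where
  "unit_vec k m = (if m = k then 1 else 0)"

definition bool_cube :: "nat \<Rightarrow> (nat \<Rightarrow> real) set" where
  "bool_cube B = {1..B} \<rightarrow>\<^sub>E {0, 1}"

subsection \<open>Gates\<close>

text \<open>The norm on \<^typ>\<open>real \<times> real\<close> is the Euclidean one.\<close>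

definition bump :: "real \<times> real \<Rightarrow> real" where
  "bump p = (if norm p < 1 / 2 then exp 1 * exp (1 / (4 * (norm p)\<^sup>2 - 1)) else 0)"

definition corner :: "nat \<Rightarrow> real \<times> real" where
  "corner k = [(0, 0), (0, 1), (1, 0), (1, 1)] ! (k - 1)"

text \<open>
  \<open>truth_table i\<close>, for \<open>i = 1, \<dots>, 16\<close>, is the vector of the four binary digits of \<open>i - 1\<close>,
  most significant digit first.
\<close>

definition truth_table :: "nat \<Rightarrow> nat \<Rightarrow> real" where
  "truth_table i k = real ((i - 1) div 2 ^ (4 - k) mod 2)"

definition gate :: "(nat \<Rightarrow> real) \<Rightarrow> real \<times> real \<Rightarrow> real" where
  "gate Z p = (\<Sum>k=1..4. bump (p - corner k) * Z k)"

subsection \<open>Stochastic Boolean circuits\<close>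

text \<open>
  In \<open>Wgate\<close>, \<open>Warg1\<close> and \<open>Warg2\<close> the first argument is the layer \<open>l\<close>, the second the row
  and the third the column.
\<close>

record sbc =
  depth :: nat
  width :: "nat \<Rightarrow> nat"
  temp :: real
  Win :: "nat \<Rightarrow> nat \<Rightarrow> real"
  Wgate :: "nat \<Rightarrow> nat \<Rightarrow> nat \<Rightarrow> real"
  Warg1 :: "nat \<Rightarrow> nat \<Rightarrow> nat \<Rightarrow> real"
  Warg2 :: "nat \<Rightarrow> nat \<Rightarrow> nat \<Rightarrow> real"

definition is_sbc :: "nat \<Rightarrow> sbc \<Rightarrow> bool" where
  "is_sbc B S \<longleftrightarrow> depth S \<ge> 1 \<and> width S 0 = B \<and> width S (depth S) = 1 \<and>
     (\<forall>l\<le>depth S. width S l \<ge> 1) \<and> temp S > 0"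

text \<open>
  Names of the random ingredients. Each ingredient is a random choice from a finite list and
  is represented by the random position chosen: \<open>Input i\<close> is \<open>q\<^sub>i\<close>, \<open>Gate l j\<close> is
  \<open>K\<^sub>l\<^sub>j\<close>, and \<open>Arg1 l j\<close>, \<open>Arg2 l j\<close> are the positions of the entry 1 in the \<open>j\<close>-th rows of
  the two one-hot matrices of layer \<open>l\<close>.
\<close>

datatype ingredient = Input nat | Arg1 nat nat | Arg2 nat nat | Gate nat nat

definition ingredients :: "sbc \<Rightarrow> ingredient set" where
  "ingredients S =
     {Input i | i. i \<in> {1..width S 1}} \<union>
     {Arg1 l j | l j. l \<in> {1..<depth S} \<and> j \<in> {1..width S (l + 1)}} \<union>
     {Arg2 l j | l j. l \<in> {1..<depth S} \<and> j \<in> {1..width S (l + 1)}} \<union>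
     {Gate l j | l j. l \<in> {1..<depth S} \<and> j \<in> {1..width S (l + 1)}}"

fun num_choices :: "sbc \<Rightarrow> ingredient \<Rightarrow> nat" where
  "num_choices S (Input i) = 2 * width S 0"
| "num_choices S (Arg1 l j) = width S l"
| "num_choices S (Arg2 l j) = width S l"
| "num_choices S (Gate l j) = 16"

fun choice_prob :: "sbc \<Rightarrow> ingredient \<Rightarrow> nat \<Rightarrow> real" where
  "choice_prob S (Input i) = softmax (2 * width S 0) (Win S i)"
| "choice_prob S (Arg1 l j) = softmax (width S l) (\<lambda>k. temp S * Warg1 S l j k)"
| "choice_prob S (Arg2 l j) = softmax (width S l)
     (\<lambda>k. temp S * (1 - softmax (width S l) (\<lambda>m. temp S * Warg1 S l j m) k)
            * softmax (width S l) (\<lambda>m. temp S * Warg2 S l j m) k)"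
| "choice_prob S (Gate l j) = softmax 16 (Wgate S l j)"

text \<open>
  \<open>X\<close> is a family of random ingredients for \<open>S\<close> on the probability space \<open>P\<close>. Only the
  marginal laws are prescribed; nothing is said about the joint law.
\<close>

definition random_ingredients ::
    "'w measure \<Rightarrow> sbc \<Rightarrow> (ingredient \<Rightarrow> 'w \<Rightarrow> nat) \<Rightarrow> bool" where
  "random_ingredients P S X \<longleftrightarrow> prob_space P \<and>
     (\<forall>s\<in>ingredients S.
        X s \<in> measurable P (count_space UNIV) \<and>
        (\<forall>\<omega>\<in>space P. X s \<omega> \<in> {1..num_choices S s}) \<and>
        (\<forall>k\<in>{1..num_choices S s}.
           measure P {\<omega> \<in> space P. X s \<omega> = k} = choice_prob S s k))"

text \<open>
  The vector \<open>x\<^sup>(\<^sup>l\<^sup>)\<close> when the ingredients take the values \<open>c\<close>. Layer 0, the input itself, is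
  there only to start the recursion.
\<close>

fun layer :: "sbc \<Rightarrow> (ingredient \<Rightarrow> nat) \<Rightarrow> (nat \<Rightarrow> real) \<Rightarrow> nat \<Rightarrow> nat \<Rightarrow> real" where
  "layer S c x 0 i = x i"
| "layer S c x (Suc 0) i =
     (let q = c (Input i); B = width S 0 in if q \<le> B then x q else 1 - x (q - B))"
| "layer S c x (Suc (Suc n)) j =
     (let l = Suc n in
        gate (truth_table (c (Gate l j)))
          (\<Sum>m=1..width S l. unit_vec (c (Arg1 l j)) m * layer S c x l m,
           \<Sum>m=1..width S l. unit_vec (c (Arg2 l j)) m * layer S c x l m))"

definition circuit ::
    "sbc \<Rightarrow> (ingredient \<Rightarrow> 'w \<Rightarrow> nat) \<Rightarrow> 'w \<Rightarrow> (nat \<Rightarrow> real) \<Rightarrow> real" where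
  "circuit S X \<omega> x = layer S (\<lambda>s. X s \<omega>) x (depth S) 1"

end

theory Submission
  imports Defs
begin

text \<open>
  A disjunctive normal form of \<open>f\<close> is evaluated by a straight-line program on \<open>B + 2\<close> registers,
  one instruction per layer. Its gates always read two distinct registers, so all weights can be
  aimed at the intended choices in such a way that each of the finitely many choices is correct
  with probability tending to 1 as the temperature \<open>\<eta>\<close> grows. A union bound over the choices then
  gives \<open>1 - \<delta>\<close>, whatever their joint law.
\<close>

subsection \<open>Concentration of the softmax\<close>

lemma softmax_nonneg: "softmax N v k \<ge> 0"
  unfolding softmax_def by (intro divide_nonneg_nonneg sum_nonneg) auto

lemma softmax_denominator_pos:
  fixes N :: nat
  assumes "N \<ge> 1"
  shows "(\<Sum>m=1..N. exp (v m :: real)) > 0"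
  using assms by (intro sum_pos) auto

lemma sum_softmax:
  assumes "N \<ge> 1"
  shows "(\<Sum>k=1..N. softmax N v k) = 1"
  using softmax_denominator_pos[OF assms, of v]
  by (simp add: softmax_def flip: sum_divide_distrib)

text \<open>The denominator is at least its single summand \<open>exp (v k)\<close>.\<close>

lemma softmax_le_exp_diff:
  assumes "k \<in> {1..N}"
  shows "softmax N v m \<le> exp (v m - v k)"
proof -
  have "exp (v k) \<le> (\<Sum>m=1..N. exp (v m))"
    using assms by (intro member_le_sum) auto
  then show ?thesis
    unfolding softmax_def exp_diff by (intro divide_left_mono mult_pos_pos)
      (auto intro: less_le_trans[OF exp_gt_zero])
qed

text \<open>The missing mass is shared by fewer than \<open>N\<close> other positions, each bounded
  by \<open>softmax_le_exp_diff\<close>.\<close>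

lemma softmax_ge:
  assumes "k \<in> {1..N}" "\<And>m. m \<in> {1..N} - {k} \<Longrightarrow> v m \<le> c"
  shows "softmax N v k \<ge> 1 - real N * exp (c - v k)"
proof -
  have "1 - softmax N v k = (\<Sum>m\<in>{1..N}-{k}. softmax N v m)"
    using sum_softmax[of N v] sum.remove[of "{1..N}" k "softmax N v"] assms(1) by simp
  also have "\<dots> \<le> (\<Sum>m\<in>{1..N}-{k}. exp (c - v k))"
    using assms(2) by (intro sum_mono order.trans[OF softmax_le_exp_diff[OF assms(1)]]) simp
  also have "\<dots> \<le> real N * exp (c - v k)"
    using assms(1) by simp
  finally show ?thesis by simp
qed

lemma softmax_le_1: "k \<in> {1..N} \<Longrightarrow> softmax N v k \<le> 1"
  using softmax_le_exp_diff[of k N v k] by simp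

text \<open>Only the peak logit has to diverge; its competitors just need a common bound. The logits
  may depend on \<open>T\<close> in any way, so that the masked softmax is covered too.\<close>

lemma softmax_tendsto_1:
  fixes v :: "real \<Rightarrow> nat \<Rightarrow> real"
  assumes k: "k \<in> {1..N}" and lim: "filterlim (\<lambda>T. v T k) at_top F"
    and bound: "eventually (\<lambda>T. \<forall>m\<in>{1..N}-{k}. v T m \<le> c) F"
  shows "((\<lambda>T. softmax N (v T) k) \<longlongrightarrow> 1) F"
proof (rule tendsto_sandwich)
  show "eventually (\<lambda>T. 1 - real N * exp (c - v T k) \<le> softmax N (v T) k) F"
    using bound by eventually_elim (intro softmax_ge k, auto)
  show "eventually (\<lambda>T. softmax N (v T) k \<le> 1) F"
    using softmax_le_1[OF k] by simp
  have "filterlim (\<lambda>T. c - v T k) at_bot F"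
    using filterlim_tendsto_add_at_top[OF tendsto_const[of "-c"] lim]
    by (simp add: filterlim_uminus_at_bot)
  then have "((\<lambda>T. exp (c - v T k)) \<longlongrightarrow> 0) F"
    by (rule filterlim_compose[OF exp_at_bot])
  then have "((\<lambda>T. 1 - real N * exp (c - v T k)) \<longlongrightarrow> 1 - real N * 0) F"
    by (intro tendsto_intros)
  then show "((\<lambda>T. 1 - real N * exp (c - v T k)) \<longlongrightarrow> 1) F" by simp
qed auto

lemma softmax_unit_vec_tendsto_1:
  assumes "k \<in> {1..N}"
  shows "((\<lambda>T. softmax N (\<lambda>m. T * unit_vec k m) k) \<longlongrightarrow> 1) at_top"
  by (rule softmax_tendsto_1[where c = 0, OF assms]) (auto simp: unit_vec_def filterlim_ident)

text \<open>
  Off its peak the second attention is at most \<open>exp (-T)\<close>, so the factor \<open>T\<close> cannot lift the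
  other logits above 1. The peak of the first attention must lie elsewhere, since otherwise the
  mask \<open>1 - softmax\<close> would suppress the desired position as well.
\<close>

lemma masked_softmax_tendsto_1:
  assumes k: "k \<in> {1..N}" and k': "k' \<in> {1..N}" and ne: "k' \<noteq> k"
  shows "((\<lambda>T. softmax N (\<lambda>m. T * (1 - softmax N (\<lambda>m. T * unit_vec k' m) m)
           * softmax N (\<lambda>m. T * unit_vec k m) m) k) \<longlongrightarrow> 1) at_top"
proof (rule softmax_tendsto_1[where c = 1, OF k])
  let ?p = "\<lambda>T k. softmax N (\<lambda>m. T * unit_vec k m)"
  have off: "?p T i m \<le> exp (-T)" if "i \<in> {1..N}" "m \<noteq> i" for T i m
    using softmax_le_exp_diff[OF that(1), of "\<lambda>m. T * unit_vec i m" m] that by (simp add: unit_vec_def)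
  have "((\<lambda>T. exp (-T :: real)) \<longlongrightarrow> 0) at_top"
    using filterlim_compose[OF exp_at_bot filterlim_uminus_at_bot_at_top] .
  then have "((\<lambda>T. ?p T k' k) \<longlongrightarrow> 0) at_top"
    by (rule tendsto_sandwich[rotated 2, OF tendsto_const]) (use off k' ne softmax_nonneg in auto)
  then have "((\<lambda>T. (1 - ?p T k' k) * ?p T k k) \<longlongrightarrow> (1 - 0) * 1) at_top"
    by (intro tendsto_intros softmax_unit_vec_tendsto_1 k)
  then have "filterlim (\<lambda>T. (1 - ?p T k' k) * ?p T k k * T) at_top at_top"
    by (intro filterlim_tendsto_pos_mult_at_top[where c = 1] filterlim_ident) auto
  then show "filterlim (\<lambda>T. T * (1 - ?p T k' k) * ?p T k k) at_top at_top"
    by (simp add: mult_ac)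
  show "eventually (\<lambda>T. \<forall>m\<in>{1..N}-{k}. T * (1 - ?p T k' m) * ?p T k m \<le> 1) at_top"
    using eventually_gt_at_top[of 0]
  proof eventually_elim
    case (elim T)
    show ?case
    proof
      fix m assume m: "m \<in> {1..N} - {k}"
      have "T * (1 - ?p T k' m) * ?p T k m \<le> T * 1 * exp (-T)"
        using elim m off[OF k] softmax_nonneg softmax_le_1[of m N]
        by (intro mult_mono) auto
      also have "\<dots> \<le> exp T * exp (-T)"
        using exp_ge_add_one_self[of T] by (intro mult_right_mono) (linarith, simp)
      finally show "T * (1 - ?p T k' m) * ?p T k m \<le> 1"
        by (simp add: exp_minus)
    qed
  qed
qed

subsection \<open>Gates and layers\<close>

lemma finite_ingredients: "finite (ingredients S)"
proof -
  have "ingredients S \<subseteq> Input ` {1..width S 1} \<union>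
      (\<Union>l\<in>{1..<depth S}. \<Union>j\<in>{1..width S (l + 1)}. {Arg1 l j, Arg2 l j, Gate l j})"
    by (auto simp: ingredients_def)
  then show ?thesis by (rule finite_subset) auto
qed

lemma ingredients_simps [simp]:
  "Input i \<in> ingredients S \<longleftrightarrow> i \<in> {1..width S 1}"
  "Arg1 l j \<in> ingredients S \<longleftrightarrow> l \<in> {1..<depth S} \<and> j \<in> {1..width S (l + 1)}"
  "Arg2 l j \<in> ingredients S \<longleftrightarrow> l \<in> {1..<depth S} \<and> j \<in> {1..width S (l + 1)}"
  "Gate l j \<in> ingredients S \<longleftrightarrow> l \<in> {1..<depth S} \<and> j \<in> {1..width S (l + 1)}"
  by (auto simp: ingredients_def)

text \<open>One outcome of all random choices, so that the layers can be studied
  deterministically.\<close>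

definition valid_choice :: "sbc \<Rightarrow> (ingredient \<Rightarrow> nat) \<Rightarrow> bool" where
  "valid_choice S c \<longleftrightarrow> (\<forall>s\<in>ingredients S. c s \<in> {1..num_choices S s})"

text \<open>These are the differences of two corners. Only the zero difference lies within radius
  1/2, and there \<open>exp 1\<close> cancels the exponent -1.\<close>

lemma bump_corners:
  "bump (0, 0) = 1" "bump (0, 1) = 0" "bump (1, 0) = 0" "bump (1, 1) = 0"
  "bump (0, -1) = 0" "bump (-1, 0) = 0" "bump (-1, -1) = 0" "bump (1, -1) = 0" "bump (-1, 1) = 0"
proof -
  have "\<not> sqrt 2 < 1 / 2"
    using real_sqrt_ge_one[of 2] by linarith
  then show "bump (0, 0) = 1" "bump (0, 1) = 0" "bump (1, 0) = 0" "bump (1, 1) = 0"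
    "bump (0, -1) = 0" "bump (-1, 0) = 0" "bump (-1, -1) = 0" "bump (1, -1) = 0" "bump (-1, 1) = 0"
    by (simp_all add: bump_def norm_Pair flip: exp_add)
qed

text \<open>At a corner exactly one bump survives; the index is the rank of \<open>(p, q)\<close> in
  binary order, counted from 1.\<close>

lemma gate_of_bool: "gate Z (of_bool p, of_bool q) = Z (1 + 2 * of_bool p + of_bool q)"
proof -
  have "{1..4} = {1, 2, 3, 4::nat}" by auto
  then show ?thesis
    \<comment> \<open>A corner minus itself simplifies to \<open>0\<close>, so the value at
      \<open>(0, 0)\<close> is restated for \<open>bump 0\<close>.\<close>
    by (cases p; cases q)
      (simp_all add: gate_def corner_def eval_nat_numeral
        bump_corners[unfolded zero_prod_def[symmetric]])
qed

lemma truth_table_bit: "truth_table i k \<in> {0, 1}"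
  by (auto simp: truth_table_def)

lemma bitE:
  assumes "(x :: real) \<in> {0, 1}"
  obtains p where "x = of_bool p"
  using assms by (metis insertE of_bool_eq singletonD)

lemma gate_bit:
  assumes "x \<in> {0, 1}" "y \<in> {0, 1}"
  shows "gate (truth_table i) (x, y) \<in> {0, 1}"
  using assms(1,2)[THEN bitE] by (metis gate_of_bool truth_table_bit)

text \<open>The digits of \<open>i - 1\<close> are read off; for \<open>i = 3\<close> they are 0010.
  The copy with \<open>Suc 0\<close> matches the simplifier's form of the index 1.\<close>

lemma gate_tables:
  "gate (truth_table 1) (of_bool p, of_bool q) = 0"
  "gate (truth_table (Suc 0)) (of_bool p, of_bool q) = 0"
  "gate (truth_table 2) (of_bool p, of_bool q) = of_bool (p \<and> q)"
  "gate (truth_table 3) (of_bool p, of_bool q) = of_bool (p \<and> \<not> q)"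
  "gate (truth_table 4) (of_bool p, of_bool q) = of_bool p"
  "gate (truth_table 8) (of_bool p, of_bool q) = of_bool (p \<or> q)"
  "gate (truth_table 16) (of_bool p, of_bool q) = 1"
  unfolding gate_of_bool by (cases p; cases q; simp add: truth_table_def)+

lemma sum_unit_vec:
  assumes "k \<in> {1..N}"
  shows "(\<Sum>m=1..N. unit_vec k m * y m) = y k"
proof -
  have "(\<Sum>m=1..N. unit_vec k m * y m) = (\<Sum>m=1..N. if m = k then y m else 0)"
    by (intro sum.cong) (auto simp: unit_vec_def)
  then show ?thesis using assms by simp
qed

text \<open>A one-hot row with its 1 in range picks out one entry; validity of the choice guarantees
  the range.\<close>

lemma layer_Suc_Suc:
  assumes "valid_choice S c" "Suc (Suc n) \<le> depth S" "j \<in> {1..width S (Suc (Suc n))}"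
  shows "layer S c x (Suc (Suc n)) j = gate (truth_table (c (Gate (Suc n) j)))
    (layer S c x (Suc n) (c (Arg1 (Suc n) j)), layer S c x (Suc n) (c (Arg2 (Suc n) j)))"
proof -
  have "Arg1 (Suc n) j \<in> ingredients S" "Arg2 (Suc n) j \<in> ingredients S"
    using assms by auto
  then have "c (Arg1 (Suc n) j) \<in> {1..width S (Suc n)}" "c (Arg2 (Suc n) j) \<in> {1..width S (Suc n)}"
    using assms(1) unfolding valid_choice_def by (metis num_choices.simps)+
  then show ?thesis by (simp add: Let_def sum_unit_vec del: One_nat_def)
qed

text \<open>Every gate maps corners to bits, so this holds for each valid choice and not only for
  the intended one. Hence the circuit is Boolean on all outcomes.\<close>

lemma layer_bit:
  assumes c: "valid_choice S c" and x: "x \<in> bool_cube (width S 0)"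
    and "l < depth S" "j \<in> {1..width S (Suc l)}"
  shows "layer S c x (Suc l) j \<in> {0, 1}"
  using assms(3,4)
proof (induction l arbitrary: j)
  case 0
  then have "Input j \<in> ingredients S" by auto
  then have *: "c (Input j) \<in> {1..2 * width S 0}"
    using c unfolding valid_choice_def by (metis num_choices.simps(1))
  have "x i \<in> {0, 1}" if "i \<in> {1..width S 0}" for i
    using x that unfolding bool_cube_def by (rule PiE_mem)
  from this[of "c (Input j)"] this[of "c (Input j) - width S 0"] show ?case
    using * by (auto simp: Let_def Suc_le_eq)
next
  case (Suc l)
  then have "Arg1 (Suc l) j \<in> ingredients S" "Arg2 (Suc l) j \<in> ingredients S" by auto
  then have "c (Arg1 (Suc l) j) \<in> {1..width S (Suc l)}" "c (Arg2 (Suc l) j) \<in> {1..width S (Suc l)}"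
    using c unfolding valid_choice_def by (metis num_choices.simps)+
  then show ?case
    using Suc by (subst layer_Suc_Suc[OF c]; (intro gate_bit Suc.IH)?) simp_all
qed

text \<open>Allows an outcome to be replaced by its restriction to the finite set of ingredients, or
  by the target choice where the two agree.\<close>

lemma layer_cong:
  assumes "\<And>s. s \<in> ingredients S \<Longrightarrow> c s = c' s" "l < depth S" "j \<in> {1..width S (Suc l)}"
    and "valid_choice S c"
  shows "layer S c x (Suc l) j = layer S c' x (Suc l) j"
  using assms(2,3)
proof (induction l arbitrary: j)
  case 0
  then show ?case using assms(1)[of "Input j"] by (simp add: Let_def)
next
  case (Suc l)
  have c': "valid_choice S c'"
    using assms(1,4) by (auto simp: valid_choice_def)
  have ingr: "Arg1 (Suc l) j \<in> ingredients S" "Arg2 (Suc l) j \<in> ingredients S" "Gate (Suc l) j \<in> ingredients S"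
    using Suc.prems by auto
  then have "c (Arg1 (Suc l) j) \<in> {1..width S (Suc l)}" "c (Arg2 (Suc l) j) \<in> {1..width S (Suc l)}"
    using assms(4) unfolding valid_choice_def by (metis num_choices.simps)+
  then show ?case
    using Suc ingr[THEN assms(1)]
    by (subst (1 2) layer_Suc_Suc) (auto simp: assms(4) c' simp del: layer.simps)
qed

subsection \<open>The union bound\<close>

lemma random_ingredients_valid:
  assumes "random_ingredients P S X" "\<omega> \<in> space P"
  shows "valid_choice S (\<lambda>s. X s \<omega>)"
  using assms by (auto simp: random_ingredients_def valid_choice_def)

text \<open>The restricted family takes values in a finite power of the naturals, a countable
  discrete space, so each predicate of it defines an event.\<close>

lemma sets_restrict_finite_family:
  assumes I: "finite I" and X: "\<And>s. s \<in> I \<Longrightarrow> X s \<in> measurable P (count_space (UNIV :: nat set))"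
  shows "{\<omega> \<in> space P. Q (\<lambda>s\<in>I. X s \<omega>)} \<in> sets P"
proof -
  have "(\<lambda>\<omega>. \<lambda>s\<in>I. X s \<omega>) \<in> measurable P (PiM I (\<lambda>_. count_space UNIV))"
    using X by (intro measurable_restrict) auto
  also have "PiM I (\<lambda>_. count_space (UNIV :: nat set)) = count_space (I \<rightarrow>\<^sub>E UNIV)"
    by (intro count_space_PiM_finite I) auto
  finally have "(\<lambda>\<omega>. \<lambda>s\<in>I. X s \<omega>) -` {c \<in> I \<rightarrow>\<^sub>E UNIV. Q c} \<inter> space P \<in> sets P"
    by (rule measurable_sets) auto
  also have "(\<lambda>\<omega>. \<lambda>s\<in>I. X s \<omega>) -` {c \<in> I \<rightarrow>\<^sub>E UNIV. Q c} \<inter> space P = {\<omega> \<in> space P. Q (\<lambda>s\<in>I. X s \<omega>)}"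
    by auto
  finally show ?thesis .
qed

text \<open>The complement is the finite union of the single misses, whose probabilities are given
  by the marginal laws.\<close>

lemma (in prob_space) prob_ingredients_eq_ge:
  assumes X: "random_ingredients M S X" and c: "valid_choice S c"
  shows "prob {\<omega> \<in> space M. \<forall>s\<in>ingredients S. X s \<omega> = c s}
    \<ge> 1 - (\<Sum>s\<in>ingredients S. 1 - choice_prob S s (c s))"
proof -
  let ?A = "\<lambda>s. {\<omega> \<in> space M. X s \<omega> = c s}"
  have A: "?A s \<in> events" "prob (?A s) = choice_prob S s (c s)" if "s \<in> ingredients S" for s
  proof -
    have [measurable]: "X s \<in> measurable M (count_space UNIV)"
      using X that by (auto simp: random_ingredients_def)
    show "?A s \<in> events" by measurable
    show "prob (?A s) = choice_prob S s (c s)"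
      using X c that by (auto simp: random_ingredients_def valid_choice_def)
  qed
  have "prob (\<Union>s\<in>ingredients S. space M - ?A s) \<le> (\<Sum>s\<in>ingredients S. prob (space M - ?A s))"
    by (intro finite_measure_subadditive_finite finite_ingredients) (use A(1) in auto)
  also have "\<dots> = (\<Sum>s\<in>ingredients S. 1 - choice_prob S s (c s))"
    by (intro sum.cong refl) (simp add: prob_compl A)
  also have "(\<Union>s\<in>ingredients S. space M - ?A s) =
      space M - {\<omega> \<in> space M. \<forall>s\<in>ingredients S. X s \<omega> = c s}"
    by auto
  also have "prob \<dots> = 1 - prob {\<omega> \<in> space M. \<forall>s\<in>ingredients S. X s \<omega> = c s}"
    by (intro prob_compl sets.sets_Collect_finite_All finite_ingredients A(1))
  finally show ?thesis by simp
qed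

lemma circuit_prob_ge:
  assumes S: "is_sbc B S" and X: "random_ingredients P S X" and c: "valid_choice S c"
    and eq: "\<And>x. x \<in> bool_cube B \<Longrightarrow> layer S c x (depth S) 1 = f x"
    and small: "(\<Sum>s\<in>ingredients S. 1 - choice_prob S s (c s)) \<le> \<delta>"
  shows "(\<forall>\<omega>\<in>space P. \<forall>x\<in>bool_cube B. circuit S X \<omega> x \<in> {0, 1}) \<and>
    measure P {\<omega> \<in> space P. \<forall>x\<in>bool_cube B. circuit S X \<omega> x = f x} \<ge> 1 - \<delta>"
proof (intro conjI ballI)
  obtain d where d: "depth S = Suc d" and w: "width S 0 = B" "width S (Suc d) = 1"
    using S by (cases "depth S") (auto simp: is_sbc_def)
  show "circuit S X \<omega> x \<in> {0, 1}" if "\<omega> \<in> space P" "x \<in> bool_cube B" for \<omega> x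
    unfolding circuit_def d
    by (rule layer_bit) (use that w d random_ingredients_valid[OF X] in auto)
  interpret prob_space P using X by (simp add: random_ingredients_def)
  let ?I = "ingredients S"
  have circuit_eq: "circuit S X \<omega> x = layer S c' x (Suc d) 1"
    if "\<omega> \<in> space P" "\<And>s. s \<in> ?I \<Longrightarrow> X s \<omega> = c' s" for \<omega> x c'
    unfolding circuit_def d
    by (rule layer_cong) (use that w d random_ingredients_valid[OF X] in auto)
  \<comment> \<open>Monotonicity of the measure needs the larger event to be measurable; it is
    expressed through finitely many ingredients for that purpose.\<close>
  have "{\<omega> \<in> space P. \<forall>x\<in>bool_cube B. circuit S X \<omega> x = f x} =
      {\<omega> \<in> space P. \<forall>x\<in>bool_cube B. layer S (\<lambda>s\<in>?I. X s \<omega>) x (Suc d) 1 = f x}"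
    by (intro Collect_cong conj_cong refl ball_cong arg_cong2[where f = "(=)"] circuit_eq) auto
  also have "\<dots> \<in> events"
    by (rule sets_restrict_finite_family) (use X finite_ingredients in \<open>auto simp: random_ingredients_def\<close>)
  finally have "prob {\<omega> \<in> space P. \<forall>s\<in>?I. X s \<omega> = c s}
      \<le> prob {\<omega> \<in> space P. \<forall>x\<in>bool_cube B. circuit S X \<omega> x = f x}"
    using circuit_eq[of _ c] eq d by (intro finite_measure_mono) auto
  with prob_ingredients_eq_ge[OF X c] small
  show "prob {\<omega> \<in> space P. \<forall>x\<in>bool_cube B. circuit S X \<omega> x = f x} \<ge> 1 - \<delta>"
    by linarith
qed

section \<open>Existence of independent ingredients\<close>

lemma num_choices_pos:
  assumes "is_sbc B S" "s \<in> ingredients S" "B \<ge> 1"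
  shows "num_choices S s \<ge> 1"
  using assms by (cases s) (auto simp: is_sbc_def)

lemma choice_prob_nonneg: "choice_prob S s k \<ge> 0"
  by (cases s) (simp_all add: softmax_nonneg)

lemma sum_choice_prob:
  "num_choices S s \<ge> 1 \<Longrightarrow> (\<Sum>k=1..num_choices S s. choice_prob S s k) = 1"
  by (cases s) (simp_all add: sum_softmax del: One_nat_def)

text \<open>The product of the prescribed laws is a model, so the theorem also speaks of an actual
  random circuit.\<close>

lemma exists_independent_ingredients:
  assumes S: "is_sbc B S" and B: "B \<ge> 1"
  shows "\<exists>(P :: (ingredient \<Rightarrow> nat) measure) X. random_ingredients P S X \<and>
    prob_space.indep_vars P (\<lambda>_. count_space UNIV) X (ingredients S)"
proof -
  let ?I = "ingredients S"
  \<comment> \<open>\<open>choice_prob\<close> is positive beyond the range as well; cutting it off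
    gives total mass 1.\<close>
  let ?w = "\<lambda>s k. if k \<in> {1..num_choices S s} then choice_prob S s k else 0"
  define p where "p s = embed_pmf (?w s)" for s
  have pmf_p: "pmf (p s) k = ?w s k" if "s \<in> ?I" for s k
    unfolding p_def
  proof (rule pmf_embed_pmf)
    have "(\<integral>\<^sup>+k. ennreal (?w s k) \<partial>count_space UNIV) =
        (\<Sum>k\<in>{1..num_choices S s}. ennreal (?w s k))"
      by (rule nn_integral_count_space') (auto simp: choice_prob_nonneg)
    also have "\<dots> = ennreal (\<Sum>k\<in>{1..num_choices S s}. ?w s k)"
      by (rule sum_ennreal) (auto simp: choice_prob_nonneg)
    also have "(\<Sum>k\<in>{1..num_choices S s}. ?w s k) = 1"
      using sum_choice_prob[OF num_choices_pos[OF S that B]] by simp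
    finally show "(\<integral>\<^sup>+k. ennreal (?w s k) \<partial>count_space UNIV) = 1" by simp
  qed (simp add: choice_prob_nonneg)
  define P where "P = measure_pmf (Pi_pmf ?I 0 p)"
  \<comment> \<open>The range condition is demanded at every sample point, while the raw coordinates
    obey it only almost surely. The default 1 is always a legal choice.\<close>
  define clamp where "clamp s k = (if k \<in> {1..num_choices S s} then k else 1)" for s k
  define X where "X s \<omega> = clamp s (\<omega> s)" for s and \<omega> :: "ingredient \<Rightarrow> nat"
  interpret prob_space P by (simp add: P_def measure_pmf.prob_space_axioms)
  have "indep_vars (\<lambda>_. count_space UNIV) (\<lambda>s \<omega>. \<omega> s) ?I"
    unfolding P_def by (rule indep_vars_Pi_pmf[OF finite_ingredients])
  then have "indep_vars (\<lambda>_. count_space UNIV) X ?I"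
    unfolding X_def by (rule indep_vars_compose2) simp
  moreover have "random_ingredients P S X"
    unfolding random_ingredients_def
  proof (intro conjI ballI)
    fix s k assume s: "s \<in> ?I"
    show "X s \<omega> \<in> {1..num_choices S s}" for \<omega>
      using num_choices_pos[OF S s B] by (simp add: X_def clamp_def)
    assume k: "k \<in> {1..num_choices S s}"
    have "map_pmf (\<lambda>\<omega>. X s \<omega>) (Pi_pmf ?I 0 p) = map_pmf (clamp s)
        (map_pmf (\<lambda>\<omega>. \<omega> s) (Pi_pmf ?I 0 p))"
      by (simp add: X_def pmf.map_comp o_def)
    also have "map_pmf (\<lambda>\<omega>. \<omega> s) (Pi_pmf ?I 0 p) = p s"
      using s by (simp add: Pi_pmf_component finite_ingredients)
    \<comment> \<open>On the support of \<open>p s\<close> clamping is the identity, so the law is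
      unchanged.\<close>
    also have "map_pmf (clamp s) (p s) = map_pmf id (p s)"
      by (intro map_pmf_cong refl) (auto simp: clamp_def set_pmf_iff pmf_p[OF s])
    finally have "pmf (map_pmf (\<lambda>\<omega>. X s \<omega>) (Pi_pmf ?I 0 p)) k = choice_prob S s k"
      using k by (simp add: pmf_p[OF s] pmf.map_id)
    then show "prob {\<omega> \<in> space P. X s \<omega> = k} = choice_prob S s k"
      by (simp add: pmf_map P_def vimage_def)
  qed (auto simp: P_def measure_pmf.prob_space_axioms)
  ultimately show ?thesis by blast
qed

subsection \<open>Aiming the weights\<close>

text \<open>The weights aim at \<open>c\<close>; raising the temperature \<open>T\<close> concentrates every law there.\<close>

definition aimed_sbc :: "nat \<Rightarrow> (nat \<Rightarrow> nat) \<Rightarrow> (ingredient \<Rightarrow> nat) \<Rightarrow> real \<Rightarrow> sbc" where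
  "aimed_sbc \<Delta> w c T = \<lparr>depth = \<Delta>, width = w, temp = T,
     Win = \<lambda>i k. T * unit_vec (c (Input i)) k,
     Wgate = \<lambda>l j k. T * unit_vec (c (Gate l j)) k,
     Warg1 = \<lambda>l j. unit_vec (c (Arg1 l j)),
     Warg2 = \<lambda>l j. unit_vec (c (Arg2 l j))\<rparr>"

lemma aimed_sbc_sel [simp]:
  "depth (aimed_sbc \<Delta> w c T) = \<Delta>" "width (aimed_sbc \<Delta> w c T) = w" "temp (aimed_sbc \<Delta> w c T) = T"
  by (simp_all add: aimed_sbc_def)

lemma aimed_sbc_ingredients: "ingredients (aimed_sbc \<Delta> w c T) = ingredients (aimed_sbc \<Delta> w c T')"
  by (simp add: ingredients_def)

text \<open>For \<open>Arg1\<close> the factor \<open>T\<close> comes from the temperature, for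
  \<open>Input\<close> and \<open>Gate\<close> from the weights; all three laws are softmaxes of a
  scaled unit vector. \<open>Arg2\<close> is the masked case, which uses \<open>ne\<close>.\<close>

lemma aimed_choice_prob_tendsto_1:
  assumes s: "s \<in> ingredients (aimed_sbc \<Delta> w c 1)" and c: "valid_choice (aimed_sbc \<Delta> w c 1) c"
    and ne: "\<And>l j. Arg1 l j \<in> ingredients (aimed_sbc \<Delta> w c 1) \<Longrightarrow> c (Arg1 l j) \<noteq> c (Arg2 l j)"
  shows "((\<lambda>T. choice_prob (aimed_sbc \<Delta> w c T) s (c s)) \<longlongrightarrow> 1) at_top"
proof -
  have cs: "c s \<in> {1..num_choices (aimed_sbc \<Delta> w c 1) s}"
    using s c by (auto simp: valid_choice_def)
  show ?thesis
  proof (cases s)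
    case (Arg2 l j)
    then have arg1: "Arg1 l j \<in> ingredients (aimed_sbc \<Delta> w c 1)"
      using s by simp
    then have "c (Arg1 l j) \<in> {1..w l}"
      using c unfolding valid_choice_def by (metis num_choices.simps(2) aimed_sbc_sel(2))
    then show ?thesis
      using cs Arg2 masked_softmax_tendsto_1[OF _ _ ne[OF arg1]] by (simp add: aimed_sbc_def)
  qed (use cs softmax_unit_vec_tendsto_1 in \<open>simp_all add: aimed_sbc_def\<close>)
qed

text \<open>The ingredients do not depend on \<open>T\<close>, so the sum is a fixed finite one
  whose terms tend to 0.\<close>

lemma exists_aimed_sbc:
  assumes c: "valid_choice (aimed_sbc \<Delta> w c 1) c"
    and ne: "\<And>l j. Arg1 l j \<in> ingredients (aimed_sbc \<Delta> w c 1) \<Longrightarrow> c (Arg1 l j) \<noteq> c (Arg2 l j)" and \<delta>: "\<delta> > 0"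
  obtains T where "T > 0"
    "(\<Sum>s\<in>ingredients (aimed_sbc \<Delta> w c T). 1 - choice_prob (aimed_sbc \<Delta> w c T) s (c s)) < \<delta>"
proof -
  let ?I = "ingredients (aimed_sbc \<Delta> w c 1)"
  have "((\<lambda>T. \<Sum>s\<in>?I. 1 - choice_prob (aimed_sbc \<Delta> w c T) s (c s)) \<longlongrightarrow> (\<Sum>s\<in>?I. 1 - 1)) at_top"
    by (intro tendsto_intros aimed_choice_prob_tendsto_1 c ne)
  then have "eventually (\<lambda>T. (\<Sum>s\<in>?I. 1 - choice_prob (aimed_sbc \<Delta> w c T) s (c s)) < \<delta>) at_top"
    by (rule order_tendstoD) (simp add: \<delta>)
  then have "eventually (\<lambda>T. (\<Sum>s\<in>?I. 1 - choice_prob (aimed_sbc \<Delta> w c T) s (c s)) < \<delta> \<and> T > 0) at_top"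
    using eventually_gt_at_top[of 0] by eventually_elim auto
  then obtain T where "T > 0" "(\<Sum>s\<in>?I. 1 - choice_prob (aimed_sbc \<Delta> w c T) s (c s)) < \<delta>"
    by (auto dest: eventually_happens)
  then show ?thesis
    using that aimed_sbc_ingredients by metis
qed

subsection \<open>Straight-line programs\<close>

text \<open>
  An instruction \<open>(t, a, b, i)\<close> writes gate \<open>i\<close> of registers \<open>a\<close> and \<open>b\<close> into register \<open>t\<close>.
  Each layer of the circuit carries out one instruction and copies the other registers by
  gate 4, the first projection.
\<close>

type_synonym instruction = "nat \<times> nat \<times> nat \<times> nat"

fun exec :: "instruction \<Rightarrow> (nat \<Rightarrow> real) \<Rightarrow> nat \<Rightarrow> real" where
  "exec (t, a, b, i) st = st(t := gate (truth_table i) (st a, st b))"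

text \<open>The condition \<open>a \<noteq> b\<close> keeps the second attention off the peak of the
  first, where the mask would suppress it.\<close>

definition valid_program :: "nat \<Rightarrow> instruction list \<Rightarrow> bool" where
  "valid_program M p \<longleftrightarrow> (\<forall>(t, a, b, i)\<in>set p. {t, a, b} \<subseteq> {1..M} \<and> a \<noteq> b \<and> i \<in> {1..16})"

text \<open>
  Register 1 is the accumulator, register 2 holds the current minterm and register \<open>i + 2\<close>
  holds the input \<open>x i\<close>. The initial bits of registers 1 and 2 are irrelevant.
\<close>

definition init_regs :: "(nat \<Rightarrow> real) \<Rightarrow> nat \<Rightarrow> real" where
  "init_regs x j = x (if j \<le> 2 then 1 else j - 2)"

text \<open>
  The second argument of a copying gate is irrelevant, but must differ from the first for the
  masked softmax.
\<close>

fun program_choice :: "instruction list \<Rightarrow> ingredient \<Rightarrow> nat" where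
  "program_choice p (Input j) = (if j \<le> 2 then 1 else j - 2)"
| "program_choice p (Arg1 l j) = (case p ! (l - 1) of (t, a, b, i) \<Rightarrow> if j = t then a else j)"
| "program_choice p (Arg2 l j) =
     (case p ! (l - 1) of (t, a, b, i) \<Rightarrow> if j = t then b else if j = 1 then 2 else 1)"
| "program_choice p (Gate l j) = (case p ! (l - 1) of (t, a, b, i) \<Rightarrow> if j = t then i else 4)"

text \<open>Layer 1 already holds the initial registers, so the last instruction is carried out in
  layer \<open>length p + 1\<close>. As the output has width 1, that layer keeps register 1
  only.\<close>

definition program_width :: "nat \<Rightarrow> instruction list \<Rightarrow> nat \<Rightarrow> nat" where
  "program_width B p l = (if l = 0 then B else if l \<le> length p then B + 2 else 1)"

definition program_sbc :: "nat \<Rightarrow> instruction list \<Rightarrow> real \<Rightarrow> sbc" where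
  "program_sbc B p = aimed_sbc (length p + 1) (program_width B p) (program_choice p)"

lemma program_sbc_sel [simp]:
  "depth (program_sbc B p T) = length p + 1" "width (program_sbc B p T) = program_width B p"
  by (simp_all add: program_sbc_def)

lemma is_sbc_program:
  assumes "B \<ge> 1" "T > 0"
  shows "is_sbc B (program_sbc B p T)"
  using assms by (simp add: is_sbc_def program_width_def program_sbc_def)

lemma valid_program_nth:
  assumes "valid_program M p" "l < length p"
  obtains t a b i where "p ! l = (t, a, b, i)"
    "t \<in> {1..M}" "a \<in> {1..M}" "b \<in> {1..M}" "a \<noteq> b" "i \<in> {1..16}"
proof -
  obtain t a b i where i: "p ! l = (t, a, b, i)" by (cases "p ! l")
  then have "(t, a, b, i) \<in> set p" using nth_mem[OF assms(2)] by simp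
  with assms(1)[unfolded valid_program_def]
  have "case (t, a, b, i) of (t, a, b, i) \<Rightarrow> {t, a, b} \<subseteq> {1..M} \<and> a \<noteq> b \<and> i \<in> {1..16}"
    by (rule bspec)
  then show ?thesis
    by (intro that[OF i]) simp_all
qed

lemma program_choice_distinct:
  assumes p: "valid_program M p" and l: "Arg1 l j \<in> ingredients (program_sbc B p T)"
  shows "program_choice p (Arg1 l j) \<noteq> program_choice p (Arg2 l j)"
proof -
  have "l - 1 < length p" using l by auto
  then obtain t a b i where "p ! (l - 1) = (t, a, b, i)" "a \<noteq> b"
    using valid_program_nth[OF p] by metis
  then show ?thesis by simp
qed

lemma valid_program_choice:
  assumes p: "valid_program (B + 2) p" and B: "B \<ge> 1" and ne: "p \<noteq> []"
  shows "valid_choice (program_sbc B p T) (program_choice p)"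
  unfolding valid_choice_def
proof
  fix s assume s: "s \<in> ingredients (program_sbc B p T)"
  \<comment> \<open>The layer read has full width; the layer written may be the last one and
    narrower.\<close>
  have width: "program_width B p l = B + 2" "program_width B p (Suc l) \<le> B + 2"
    if "l \<in> {1..<length p + 1}" for l
    using that by (auto simp: program_width_def)
  have instr: thesis
    if "l \<in> {1..<length p + 1}"
      "\<And>t a b i. p ! (l - 1) = (t, a, b, i) \<Longrightarrow> a \<in> {1..B + 2} \<Longrightarrow> b \<in> {1..B + 2} \<Longrightarrow>
        i \<in> {1..16} \<Longrightarrow> thesis" for l thesis
  proof -
    have "l - 1 < length p" using that(1) by auto
    then show ?thesis by (rule valid_program_nth[OF p]) (rule that(2))
  qed
  show "program_choice p s \<in> {1..num_choices (program_sbc B p T) s}"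
  proof (cases s)
    case (Input j)
    then show ?thesis using s B ne by (auto simp: program_width_def split: if_splits)
  next
    case (Arg1 l j)
    then have l: "l \<in> {1..<length p + 1}" using s by simp
    then show ?thesis using Arg1 s width[OF l] by (elim instr) auto
  next
    case (Arg2 l j)
    then have l: "l \<in> {1..<length p + 1}" using s by simp
    then show ?thesis using Arg2 s width[OF l] by (elim instr) auto
  next
    case (Gate l j)
    then have l: "l \<in> {1..<length p + 1}" using s by simp
    then show ?thesis using Gate by (elim instr) auto
  qed
qed

text \<open>Induction on \<open>l\<close>: register \<open>t\<close> receives the gate value and all
  others are copied. The shift to \<open>Suc l\<close> arises because layer 1 precedes the first
  instruction.\<close>

lemma layer_program:
  assumes p: "valid_program (B + 2) p" and B: "B \<ge> 1" and ne: "p \<noteq> []" and x: "x \<in> bool_cube B"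
    and "l \<le> length p" "j \<in> {1..program_width B p (Suc l)}"
  shows "layer (program_sbc B p T) (program_choice p) x (Suc l) j = fold exec (take l p) (init_regs x) j"
  using assms(5,6)
proof (induction l arbitrary: j)
  case 0
  \<comment> \<open>Input choices are at most \<open>B\<close> here, so unnegated entries are
    selected.\<close>
  then show ?case using B ne by (auto simp: init_regs_def program_width_def Let_def split: if_splits)
next
  case (Suc l)
  let ?S = "program_sbc B p T" and ?c = "program_choice p"
  let ?st = "fold exec (take l p) (init_regs x)"
  have width: "program_width B p (Suc l) = B + 2" and j: "j \<in> {1..B+2}"
    using Suc.prems by (auto simp: program_width_def split: if_splits)
  have IH: "layer ?S ?c x (Suc l) k = ?st k" if "k \<in> {1..B+2}" for k
    using Suc that width by simp
  note valid = valid_program_choice[OF p B ne, of T]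
  \<comment> \<open>Gate 4 is a projection on bits only, so copying relies on this.\<close>
  have bit: "?st k \<in> {0, 1}" if "k \<in> {1..B+2}" for k
    using layer_bit[OF valid, of x l k] IH[OF that] that width x Suc.prems
    by (simp add: program_width_def)
  obtain t a b i where i: "p ! l = (t, a, b, i)" "t \<in> {1..B+2}" "a \<in> {1..B+2}" "b \<in> {1..B+2}"
    using valid_program_nth[OF p, of l] Suc.prems by (metis Suc_le_lessD)
  have run: "fold exec (take (Suc l) p) (init_regs x) = ?st(t := gate (truth_table i) (?st a, ?st b))"
    using Suc.prems i by (simp add: take_Suc_conv_app_nth)
  have copy: "gate (truth_table 4) (?st k, ?st k') = ?st k" if k: "k \<in> {1..B+2}" "k' \<in> {1..B+2}" for k k'
  proof -
    obtain q q' where "?st k = of_bool q" "?st k' = of_bool q'"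
      using bit[OF k(1)] bit[OF k(2)] by (meson bitE)
    then show ?thesis by (simp add: gate_tables)
  qed
  have "layer ?S ?c x (Suc (Suc l)) j = gate (truth_table (?c (Gate (Suc l) j)))
      (layer ?S ?c x (Suc l) (?c (Arg1 (Suc l) j)), layer ?S ?c x (Suc l) (?c (Arg2 (Suc l) j)))"
    using Suc.prems by (intro layer_Suc_Suc valid) auto
  also have "\<dots> = (?st(t := gate (truth_table i) (?st a, ?st b))) j"
  proof (cases "j = t")
    case True
    then show ?thesis using i by (simp add: IH del: layer.simps)
  next
    case False
    define k' where "k' = (if j = 1 then 2 else 1 :: nat)"
    have "k' \<in> {1..B + 2}" by (simp add: k'_def)
    moreover have "?c (Gate (Suc l) j) = 4" "?c (Arg1 (Suc l) j) = j" "?c (Arg2 (Suc l) j) = k'"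
      using False i by (simp_all add: k'_def)
    ultimately show ?thesis using False by (simp add: IH[OF j] IH copy[OF j] del: layer.simps program_choice.simps)
  qed
  finally show ?case unfolding run .
qed

text \<open>Gate 16 sets register 2 to 1, gates 2 and 3 conjoin a plain or negated literal to it,
  and gate 8 joins the minterm to the accumulator by disjunction.\<close>

definition minterm_program :: "nat \<Rightarrow> (nat \<Rightarrow> real) \<Rightarrow> instruction list" where
  "minterm_program B a = (2, 1, 2, 16) # map (\<lambda>i. (2, 2, i + 2, if a i = 1 then 2 else 3)) [1..<B + 1]
     @ [(1, 1, 2, 8)]"

text \<open>Gate 1 clears the accumulator, which starts with the bit \<open>x 1\<close>; it also
  makes the program nonempty when \<open>as\<close> is empty.\<close>

definition dnf_program :: "nat \<Rightarrow> (nat \<Rightarrow> real) list \<Rightarrow> instruction list" where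
  "dnf_program B as = (1, 1, 2, 1) # concat (map (minterm_program B) as)"

lemma valid_dnf_program: "B \<ge> 1 \<Longrightarrow> valid_program (B + 2) (dnf_program B as)"
  by (auto simp: valid_program_def dnf_program_def minterm_program_def)

lemma fold_minterm_product:
  assumes x: "x \<in> bool_cube B" and a: "a \<in> bool_cube B"
    and st: "st 2 = 1" "\<And>i. i \<in> {1..B} \<Longrightarrow> st (i + 2) = x i" and n: "n \<le> B"
  shows "fold exec (map (\<lambda>i. (2, 2, i + 2, if a i = 1 then 2 else 3)) [1..<n + 1]) st =
    st(2 := of_bool (\<forall>i\<in>{1..n}. x i = a i))"
  using n
proof (induction n)
  case 0
  then show ?case using st by auto
next
  case (Suc n)
  have "x (Suc n) \<in> {0, 1}" "a (Suc n) \<in> {0, 1}"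
    using x a Suc.prems unfolding bool_cube_def by (auto dest!: PiE_mem[where x = "Suc n"])
  then obtain p q where pq: "x (Suc n) = of_bool p" "a (Suc n) = of_bool q"
    by (meson bitE)
  have st': "st (Suc (Suc (Suc n))) = of_bool p"
    using st(2)[of "Suc n"] Suc.prems pq by simp
  let ?g = "\<lambda>i. (2, 2, i + 2, if a i = 1 then 2 else 3) :: instruction"
  have "fold exec (map ?g [1..<Suc n + 1]) st = exec (?g (Suc n)) (fold exec (map ?g [1..<n + 1]) st)"
    by (simp add: upt_Suc)
  also have "fold exec (map ?g [1..<n + 1]) st = st(2 := of_bool (\<forall>i\<in>{1..n}. x i = a i))"
    using Suc.prems by (intro Suc.IH) simp
  \<comment> \<open>If \<open>q\<close> holds, gate 2 conjoins \<open>p\<close>, otherwise gate 3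
    conjoins its negation; both amount to \<open>p = q\<close>.\<close>
  also have "exec (?g (Suc n)) \<dots> = st(2 := of_bool ((\<forall>i\<in>{1..n}. x i = a i) \<and> p = q))"
    using st' pq(2) by (cases q) (simp_all add: gate_tables)
  also have "(\<forall>i\<in>{1..n}. x i = a i) \<and> p = q \<longleftrightarrow> (\<forall>i\<in>{1..Suc n}. x i = a i)"
    using pq by (auto simp: atLeastAtMostSuc_conv)
  finally show ?case .
qed

lemma fold_minterm_program:
  assumes x: "x \<in> bool_cube B" and a: "a \<in> bool_cube B"
    and st: "st 1 = of_bool r" "st 2 \<in> {0, 1}" "\<And>i. i \<in> {1..B} \<Longrightarrow> st (i + 2) = x i"
  shows "fold exec (minterm_program B a) st = st(1 := of_bool (r \<or> x = a), 2 := of_bool (x = a))"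
proof -
  obtain q where q: "st 2 = of_bool q" using st(2) by (rule bitE)
  \<comment> \<open>Both functions are \<open>undefined\<close> outside \<open>{1..B}\<close>, so
    agreement there is equality.\<close>
  have eq: "(\<forall>i\<in>{1..B}. x i = a i) \<longleftrightarrow> x = a"
    using x a unfolding bool_cube_def by (auto intro: PiE_ext)
  \<comment> \<open>Even gate 16 is constant on bits only, hence the assumptions on
    \<open>st 1\<close> and \<open>st 2\<close>.\<close>
  have "fold exec [(2, 1, 2, 16)] st = st(2 := 1)"
    using st(1) q by (simp add: gate_tables)
  moreover have "fold exec (map (\<lambda>i. (2, 2, i + 2, if a i = 1 then 2 else 3)) [1..<B + 1]) (st(2 := 1))
      = st(2 := of_bool (x = a))"
    using fold_minterm_product[OF x a, of "st(2 := 1)" B] st(3) eq by simp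
  ultimately show ?thesis
    using st(1) by (simp add: minterm_program_def gate_tables fun_upd_twist del: upt_Suc)
qed

text \<open>A minterm changes registers 1 and 2 only and leaves bits there, so the hypotheses hold
  again with new \<open>st\<close> and \<open>r\<close>.\<close>

lemma fold_minterm_programs:
  assumes x: "x \<in> bool_cube B" and as: "set as \<subseteq> bool_cube B"
    and st: "st 1 = of_bool r" "st 2 \<in> {0, 1}" "\<And>i. i \<in> {1..B} \<Longrightarrow> st (i + 2) = x i"
  shows "fold exec (concat (map (minterm_program B) as)) st 1 = of_bool (r \<or> x \<in> set as)"
  using as st
proof (induction as arbitrary: st r)
  case (Cons a as)
  let ?st = "st(1 := of_bool (r \<or> x = a), 2 := of_bool (x = a))"
  have "fold exec (concat (map (minterm_program B) as)) ?st 1 = of_bool ((r \<or> x = a) \<or> x \<in> set as)"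
    by (rule Cons.IH) (use Cons.prems in auto)
  then show ?case
    using fold_minterm_program[OF x, of a st r] Cons.prems by (auto simp del: fun_upd_apply)
qed simp

lemma fold_dnf_program:
  assumes x: "x \<in> bool_cube B" and as: "set as \<subseteq> bool_cube B" and B: "B \<ge> 1"
  shows "fold exec (dnf_program B as) (init_regs x) 1 = of_bool (x \<in> set as)"
proof -
  have x1: "x 1 \<in> {0, 1}"
    using x B unfolding bool_cube_def by (auto dest!: PiE_mem[where x = 1])
  then obtain p where p: "x 1 = of_bool p" by (rule bitE)
  have "exec (1, 1, 2, 1) (init_regs x) = (init_regs x)(1 := 0)"
    using p by (simp add: init_regs_def gate_tables)
  then show ?thesis
    using fold_minterm_programs[OF x as, of "(init_regs x)(1 := 0)" False] x1
    by (simp add: dnf_program_def init_regs_def)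
qed

lemma finite_bool_cube: "finite (bool_cube B)"
  unfolding bool_cube_def by (intro finite_PiE) auto

section \<open>Assembling the circuit\<close>

theorem theorem4p2:
  fixes B :: nat and f :: "(nat \<Rightarrow> real) \<Rightarrow> real" and \<delta> :: real
  assumes "B \<ge> 1"
    and "f \<in> bool_cube B \<rightarrow> {0, 1}"
    and "0 < \<delta>" and "\<delta> \<le> 1"
  shows "\<exists>S. is_sbc B S \<and>
    (\<exists>(P :: (ingredient \<Rightarrow> nat) measure) X.
       random_ingredients P S X \<and>
       prob_space.indep_vars P (\<lambda>_. count_space UNIV) X (ingredients S) \<and>
       (\<forall>\<omega>\<in>space P. \<forall>x\<in>bool_cube B. circuit S X \<omega> x \<in> {0, 1}) \<and>
       measure P {\<omega> \<in> space P. \<forall>x\<in>bool_cube B. circuit S X \<omega> x = f x} \<ge> 1 - \<delta>) \<and>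
    (\<forall>(P :: 'w measure) X.
       random_ingredients P S X \<longrightarrow>
       (\<forall>\<omega>\<in>space P. \<forall>x\<in>bool_cube B. circuit S X \<omega> x \<in> {0, 1}) \<and>
       measure P {\<omega> \<in> space P. \<forall>x\<in>bool_cube B. circuit S X \<omega> x = f x} \<ge> 1 - \<delta>)"
proof -
  \<comment> \<open>The minterms are the inputs that \<open>f\<close> accepts.\<close>
  have "finite {a \<in> bool_cube B. f a = 1}"
    using finite_bool_cube by simp
  then obtain as where as: "set as = {a \<in> bool_cube B. f a = 1}"
    by (meson finite_list)
  define p where "p = dnf_program B as"
  have p: "valid_program (B + 2) p" "p \<noteq> []"
    using valid_dnf_program[OF assms(1)] by (simp_all add: p_def dnf_program_def)
  note valid = valid_program_choice[OF p(1) assms(1) p(2)]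
  obtain T where T: "T > 0" and
    small: "(\<Sum>s\<in>ingredients (program_sbc B p T).
      1 - choice_prob (program_sbc B p T) s (program_choice p s)) < \<delta>"
    using exists_aimed_sbc[OF valid[of 1, unfolded program_sbc_def]
        program_choice_distinct[OF p(1), of _ _ B 1, unfolded program_sbc_def] assms(3)]
    unfolding program_sbc_def by metis
  define S where "S = program_sbc B p T"
  have S: "is_sbc B S"
    unfolding S_def by (rule is_sbc_program[OF assms(1) T])
  have eq: "layer S (program_choice p) x (depth S) 1 = f x" if x: "x \<in> bool_cube B" for x
  proof -
    have "layer S (program_choice p) x (depth S) 1 = fold exec p (init_regs x) 1"
      using layer_program[OF p(1) assms(1) p(2) x, of "length p" 1 T]
      by (simp add: S_def program_width_def)
    also have "\<dots> = of_bool (x \<in> set as)"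
      unfolding p_def by (rule fold_dnf_program[OF x _ assms(1)]) (auto simp: as)
    also have "\<dots> = f x"
      using x assms(2) by (auto simp: as)
    finally show ?thesis .
  qed
  \<comment> \<open>This fact is polymorphic in the sample space, so it serves both the independent
    model and an arbitrary \<open>P\<close>.\<close>
  note circuit_ge = circuit_prob_ge[OF S _ valid[of T, folded S_def] eq
      less_imp_le[OF small[folded S_def]]]
  obtain P :: "(ingredient \<Rightarrow> nat) measure" and X where
    "random_ingredients P S X" "prob_space.indep_vars P (\<lambda>_. count_space UNIV) X (ingredients S)"
    using exists_independent_ingredients[OF S assms(1)] by blast
  with S show ?thesis
    by (intro exI[of _ S] conjI exI[of _ P] exI[of _ X] allI impI
        circuit_ge[THEN conjunct1] circuit_ge[THEN conjunct2])
qed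

end
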